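(* The path Turán number $p(4)$ satisfies \[ p(4) \leq \frac{1}{4}. \]
   Context: All infinite graphs here are simple graphs $G$ with vertex set $V(G) = \mathbb{N} = \{1,2,3,\dots\}$. For an integer $k \ge 1$, an increasing path of length $k$ in $G$, denoted $I_k$, is a sequence of $k+1$ vertices $i_1 < i_2 < \dots < i_{k+1}$ such that $i_j$ is adjacent to $i_{j+1}$ for $1 \leq j \leq k$. The graph $G$ is $I_k$-free if it contains no increasing path of length $k$. Let $G_n$ be the subgraph of $G$ induced by $\{1,2,\dots,n\}$, let $e(G_n)$ be its number of edges, and let $p(G) = \liminf_{n \to \infty} \frac{e(G_n)}{n^2}$. For $k \ge 2$, the path Turán number of $I_k$ is $p(k) = \sup\{ p(G) : G \text{ is } I_k\text{-free}\}$. *)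

theory Defs
  imports "HOL-Analysis.Analysis"
begin

text \<open>A simple graph on the vertex set \<open>{1, 2, 3, \<dots>}\<close> is given by its set of edges, an edge
  being a two-element set of vertices; \<open>0 :: nat\<close> is not a vertex.\<close>

abbreviation vertices :: "nat set" where
  "vertices \<equiv> {1..}"

definition graph :: "nat set set \<Rightarrow> bool" where
  "graph E \<longleftrightarrow> (\<forall>e\<in>E. e \<subseteq> vertices \<and> card e = 2)"

definition increasing_path :: "nat set set \<Rightarrow> nat \<Rightarrow> nat list \<Rightarrow> bool" where
  "increasing_path E k xs \<longleftrightarrow>
     length xs = k + 1 \<and> set xs \<subseteq> vertices \<and> sorted_wrt (<) xs \<and>
     (\<forall>j<k. {xs ! j, xs ! (j + 1)} \<in> E)"

definition I_free :: "nat \<Rightarrow> nat set set \<Rightarrow> bool" where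
  "I_free k E \<longleftrightarrow> (\<nexists>xs. increasing_path E k xs)"

definition induced_edges :: "nat set set \<Rightarrow> nat \<Rightarrow> nat set set" where
  "induced_edges E n = {e \<in> E. e \<subseteq> {1..n}}"

text \<open>The lower limit and the supremum are taken in \<^typ>\<open>ereal\<close>, where they always exist. Each
  ratio lies in \<open>[0, 1/2]\<close>, so the values are those in the reals; the term for \<open>n = 0\<close>, which is
  \<open>0 / 0 = 0\<close>, does not affect the lower limit.\<close>

definition lower_density :: "nat set set \<Rightarrow> ereal" where
  "lower_density E = liminf (\<lambda>n. ereal (real (card (induced_edges E n)) / (real n)\<^sup>2))"

definition path_turan :: "nat \<Rightarrow> ereal" where
  "path_turan k = (SUP E \<in> {E. graph E \<and> I_free k E}. lower_density E)"

end

theory Submission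
  imports Defs
begin

text \<open>
  Colour each vertex by the length of the longest increasing path that ends there. In an
  \<open>I\<^sub>4\<close>-free graph the colours are \<open>0, 1, 2, 3\<close>, and they strictly increase along every edge
  directed from its smaller to its larger endpoint. So the edges of \<open>G\<^sub>n\<close> are among the
  ascents \<open>i < j\<close>, \<open>f i < f j\<close> of a word \<open>f\<close> over four letters, and it suffices to show that no
  infinite word over four letters has more than \<open>n\<^sup>2 / 4\<close> ascents \<open>a(n)\<close> among its first \<open>n\<close> letters
  for all large \<open>n\<close>. A finite word can have nearly \<open>3 n\<^sup>2 / 8\<close> of them, by listing its letters in
  increasing order; the point is that a word cannot be good at every scale.

  This is a Lyapunov argument. Let \<open>x\<^sub>c\<close> be the number of letters \<open>c\<close> among the first \<open>n\<close>,
  and consider the potential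
  \[ P(n) = 4 a(n) + (x_0^2 + x_1^2 + x_2^2 + x_3^2) + n (3 x_0 + 2 x_1 + x_2). \]
  Whichever letter comes next, completing squares gives
  \[ n (P(n + 1) - P(n)) \le 2 P(n) - 8 a(n) + 7 n^2 / 4 + 4 n \]
  (lemma \<open>potential_step\<close>). If \<open>a(n) > n\<^sup>2 / 4\<close> for all large \<open>n\<close>, the right-hand side is at most
  \<open>2 P(n) - n\<^sup>2 / 8\<close>, so the bounded ratio \<open>P(n) / n\<^sup>2\<close>, which would not increase if
  \<open>n (P(n + 1) - P(n))\<close> were \<open>2 P(n)\<close>, drops at each step by at least a constant over \<open>n\<close>. The
  harmonic series diverges, so the ratio would become negative, which is absurd.
\<close>


section \<open>Colouring by longest increasing paths\<close>

text \<open>This is the only place where the absence of long increasing paths enters. Extending a longest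
  path that ends at \<open>i\<close> by the edge to \<open>j\<close> shows that the colour grows along the edge.\<close>

lemma I_free_colouring:
  assumes "graph E" "I_free k E"
  obtains f :: "nat \<Rightarrow> nat"
  where "\<And>v. v \<in> vertices \<Longrightarrow> f v < k"
    and "\<And>i j. i < j \<Longrightarrow> {i, j} \<in> E \<Longrightarrow> f i < f j"
proof -
  define L where "L v = {l. \<exists>xs. increasing_path E l xs \<and> last xs = v}" for v
  have bound: "l < k" if "l \<in> L v" for l v
  proof (rule ccontr)
    assume "\<not> l < k"
    from that obtain xs where "increasing_path E l xs"
      by (auto simp: L_def)
    with \<open>\<not> l < k\<close> have "increasing_path E k (take (k + 1) xs)"
      by (auto simp: increasing_path_def sorted_wrt_take dest: in_set_takeD)
    with assms(2) show False
      by (auto simp: I_free_def)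
  qed
  have fin: "finite (L v)" for v
    using bound by (intro finite_subset[of "L v" "{..<k}"]) auto
  have trivial_path: "0 \<in> L v" if "v \<in> vertices" for v
    unfolding L_def using that
    by (intro CollectI exI[of _ "[v]"]) (auto simp: increasing_path_def)
  have extend: "Suc l \<in> L j" if "l \<in> L i" "i < j" "{i, j} \<in> E" for l i j
  proof -
    from that(1) obtain xs where xs: "increasing_path E l xs" "last xs = i"
      by (auto simp: L_def)
    have len: "length xs = Suc l" and "xs \<noteq> []"
      using xs(1) by (auto simp: increasing_path_def)
    have last: "xs ! l = i"
      using xs(2) len \<open>xs \<noteq> []\<close> by (simp add: last_conv_nth)
    have "sorted_wrt (<) xs"
      using xs(1) by (simp add: increasing_path_def)
    have below: "x \<le> i" if x: "x \<in> set xs" for x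
    proof -
      obtain m where m: "m < length xs" "x = xs ! m"
        using x by (auto simp: in_set_conv_nth)
      show ?thesis
      proof (cases "m = l")
        case False
        with m len have "m < l" by simp
        then show ?thesis
          using sorted_wrt_nth_less[OF \<open>sorted_wrt (<) xs\<close>, of m l] len last m by simp
      qed (use m last in simp)
    qed
    have "increasing_path E (Suc l) (xs @ [j])"
      unfolding increasing_path_def
    proof (intro conjI allI impI)
      show "set (xs @ [j]) \<subseteq> vertices"
        using xs(1) \<open>{i, j} \<in> E\<close> assms(1) by (auto simp: increasing_path_def graph_def)
      show "sorted_wrt (<) (xs @ [j])"
        using \<open>sorted_wrt (<) xs\<close> below \<open>i < j\<close> by (force simp: sorted_wrt_append)
      show "{(xs @ [j]) ! m, (xs @ [j]) ! (m + 1)} \<in> E" if "m < Suc l" for m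
        using that xs(1) \<open>{i, j} \<in> E\<close> len last
        by (cases "m = l") (auto simp: increasing_path_def nth_append)
    qed (use len in simp)
    then show ?thesis
      by (auto simp: L_def)
  qed
  show thesis
  proof (rule that[of "\<lambda>v. Max (L v)"])
    show "Max (L v) < k" if "v \<in> vertices" for v
      using bound[of "Max (L v)" v] Max_in[OF fin[of v]] trivial_path[OF that] by auto
  next
    fix i j :: nat
    assume ij: "i < j" "{i, j} \<in> E"
    then have "i \<in> vertices"
      using assms(1) by (auto simp: graph_def)
    then have "Max (L i) \<in> L i"
      using Max_in[OF fin[of i]] trivial_path by auto
    from extend[OF this ij] show "Max (L i) < Max (L j)"
      using Max_ge[OF fin[of j], of "Suc (Max (L i))"] by (simp add: Suc_le_eq)
  qed
qed


section \<open>Ascents and letter counts of an infinite word\<close>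

definition ascents :: "(nat \<Rightarrow> nat) \<Rightarrow> nat \<Rightarrow> nat" where
  "ascents f n = (\<Sum>j = 1..n. card {i \<in> {1..<j}. f i < f j})"

definition letter_count :: "(nat \<Rightarrow> nat) \<Rightarrow> nat \<Rightarrow> nat \<Rightarrow> nat" where
  "letter_count f c n = card {i \<in> {1..n}. f i = c}"

lemma card_induced_edges_le_ascents:
  assumes "graph E" and mono: "\<And>i j. i < j \<Longrightarrow> {i, j} \<in> E \<Longrightarrow> f i < f j"
  shows "card (induced_edges E n) \<le> ascents f n"
proof -
  define S where "S = (SIGMA j:{1..n}. {i \<in> {1..<j}. f i < f j})"
  have "finite S"
    by (auto simp: S_def)
  have "induced_edges E n \<subseteq> (\<lambda>(j, i). {i, j}) ` S"
  proof
    fix e assume e: "e \<in> induced_edges E n"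
    then have "e \<in> E" "e \<subseteq> {1..n}"
      by (auto simp: induced_edges_def)
    with assms(1) have "card e = 2"
      by (auto simp: graph_def)
    then obtain a b where ab: "e = {a, b}" "a \<noteq> b"
      by (auto simp: card_2_iff)
    obtain i j where ij: "e = {i, j}" "i < j"
      by (metis ab insert_commute linorder_neqE_nat)
    then have "(j, i) \<in> S"
      using \<open>e \<in> E\<close> \<open>e \<subseteq> {1..n}\<close> mono by (auto simp: S_def)
    with ij(1) show "e \<in> (\<lambda>(j, i). {i, j}) ` S"
      by force
  qed
  then have "card (induced_edges E n) \<le> card S"
    using \<open>finite S\<close> by (meson card_image_le card_mono finite_imageI order_trans)
  also have "card S = ascents f n"
    unfolding S_def ascents_def by (subst card_SigmaI) auto
  finally show ?thesis .
qed

lemma letter_count_Suc: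
  "letter_count f c (Suc n) = letter_count f c n + (if f (Suc n) = c then 1 else 0)"
proof -
  have "{i \<in> {1..Suc n}. f i = c} =
      {i \<in> {1..n}. f i = c} \<union> (if f (Suc n) = c then {Suc n} else {})"
    by (auto simp: le_Suc_eq)
  then show ?thesis
    by (simp add: letter_count_def card_insert_if)
qed

lemma card_smaller_letters: "card {i \<in> {1..n}. f i < c} = (\<Sum>d<c. letter_count f d n)"
proof -
  have "{i \<in> {1..n}. f i < c} = (\<Union>d\<in>{..<c}. {i \<in> {1..n}. f i = d})"
    by auto
  then show ?thesis
    by (simp add: letter_count_def card_UN_disjoint disjoint_iff)
qed

lemma ascents_Suc:
  "ascents f (Suc n) = ascents f n + (\<Sum>d<f (Suc n). letter_count f d n)"
  using card_smaller_letters[of n f "f (Suc n)"]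
  by (simp add: ascents_def less_Suc_eq_le)

lemma sum_letter_count:
  assumes "\<And>v. v \<in> vertices \<Longrightarrow> f v < k"
  shows "(\<Sum>c<k. letter_count f c n) = n"
proof -
  have "{i \<in> {1..n}. f i < k} = {1..n}"
    using assms by auto
  then show ?thesis
    using card_smaller_letters[of n f k] by simp
qed


section \<open>The potential\<close>

text \<open>The letter \<open>3\<close> always creates the most new ascents, whereas smaller letters create few but
  prepare later ones. The linear term books this preparation as a gain at the time when a small
  letter is used; it is lost again as the frequency of the letter declines. The quadratic term
  changes the gain of a letter from \<open>x\<^sub>0 + \<dots> + x\<^bsub>c-1\<^esub>\<close> to
  \<open>x\<^sub>0 + \<dots> + x\<^bsub>c-1\<^esub> + x\<^sub>c / 2\<close>. The coefficients are chosen such that, at equal letter frequencies,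
  all four letters change the ratio of the potential to \<open>n\<^sup>2\<close> by the same amount to leading order.\<close>

definition potential :: "(nat \<Rightarrow> nat) \<Rightarrow> nat \<Rightarrow> real" where
  "potential f n = 4 * real (ascents f n) + (\<Sum>c<4. (real (letter_count f c n))\<^sup>2)
     + real n * (\<Sum>c<4. (3 - real c) * real (letter_count f c n))"

lemma potential_nonneg: "0 \<le> potential f n"
  unfolding potential_def by (intro add_nonneg_nonneg mult_nonneg_nonneg sum_nonneg) auto

text \<open>With \<open>H = 3 x\<^sub>0 + 2 x\<^sub>1 + x\<^sub>2\<close>, the letter \<open>c\<close> adds
  \<open>4 (x\<^sub>0 + \<dots> + x\<^bsub>c-1\<^esub>) + 2 x\<^sub>c + 1 + H + (n + 1) (3 - c)\<close> to the potential. For each \<open>c\<close> the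
  difference of the two sides is a sum of squares plus the error term \<open>n c\<close>: the sum is
  \<open>2 (\<Sum>\<^sub>i (x\<^sub>i - b\<^sub>i n)\<^sup>2)\<close>, where \<open>(b\<^sub>0, b\<^sub>1, b\<^sub>2, b\<^sub>3)\<close> is a rearrangement of
  \<open>(0, 1/4, 1/4, 1/2)\<close> that depends on \<open>c\<close>.\<close>

lemma potential_step:
  assumes f: "\<And>v. v \<in> vertices \<Longrightarrow> f v < 4"
  shows "real n * (potential f (Suc n) - potential f n)
    \<le> 2 * potential f n - 8 * real (ascents f n) + 7 / 4 * (real n)\<^sup>2 + 4 * real n"
proof -
  define w x y z where "w = real (letter_count f 0 n)" and "x = real (letter_count f 1 n)"
    and "y = real (letter_count f 2 n)" and "z = real (letter_count f 3 n)"
  note counts = w_def x_def y_def z_def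
  have less4: "{..<4} = {0, 1, 2, 3 :: nat}" and less3: "{..<3} = {0, 1, 2 :: nat}"
    and less2: "{..<2} = {0, 1 :: nat}" and less1: "{..<1} = {0 :: nat}"
    by auto
  have "(\<Sum>c<4. letter_count f c n) = n"
    using f by (rule sum_letter_count)
  then have n: "real n = w + x + y + z"
    unfolding counts less4 by simp
  have P: "potential f n = 4 * real (ascents f n) + (w\<^sup>2 + x\<^sup>2 + y\<^sup>2 + z\<^sup>2)
      + real n * (3 * w + 2 * x + y)"
    by (simp add: potential_def less4 counts)
  \<comment> \<open>Eight times the surplus of the right-hand side, with \<open>p, q, r, s\<close> four times the
    coefficients \<open>b\<^sub>0, b\<^sub>1, b\<^sub>2, b\<^sub>3\<close> that belong to the next letter \<open>c\<close>.\<close>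
  have surplus: "0 \<le> 8 * real n * real c + (4 * w - p * real n)\<^sup>2 + (4 * x - q * real n)\<^sup>2
      + (4 * y - r * real n)\<^sup>2 + (4 * z - s * real n)\<^sup>2" for c :: nat and p q r s
    by (intro add_nonneg_nonneg mult_nonneg_nonneg) auto
  have "f (Suc n) < 4"
    using f by simp
  then consider "f (Suc n) = 0" | "f (Suc n) = 1" | "f (Suc n) = 2" | "f (Suc n) = 3"
    by linarith
  then show ?thesis
  proof cases
    case 1
    then have "potential f (Suc n) = 4 * real (ascents f n) + ((w + 1)\<^sup>2 + x\<^sup>2 + y\<^sup>2 + z\<^sup>2)
      + (real n + 1) * (3 * (w + 1) + 2 * x + y)"
      by (simp add: potential_def ascents_Suc letter_count_Suc less4 counts add_ac)
    then show ?thesis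
      using surplus[of 0 1 0 1 2] unfolding P n
      by (simp add: power2_eq_square field_simps)
  next
    case 2
    then have "potential f (Suc n) = 4 * (real (ascents f n) + w) + (w\<^sup>2 + (x + 1)\<^sup>2 + y\<^sup>2 + z\<^sup>2)
      + (real n + 1) * (3 * w + 2 * (x + 1) + y)"
      by (simp add: potential_def ascents_Suc letter_count_Suc less4 less1 counts add_ac)
    then show ?thesis
      using surplus[of 1 2 1 0 1] unfolding P n
      by (simp add: power2_eq_square field_simps)
  next
    case 3
    then have "potential f (Suc n) = 4 * (real (ascents f n) + w + x)
      + (w\<^sup>2 + x\<^sup>2 + (y + 1)\<^sup>2 + z\<^sup>2) + (real n + 1) * (3 * w + 2 * x + (y + 1))"
      by (simp add: potential_def ascents_Suc letter_count_Suc less4 less2 counts add_ac)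
    then show ?thesis
      using surplus[of 2 1 2 1 0] unfolding P n
      by (simp add: power2_eq_square field_simps)
  next
    case 4
    then have "potential f (Suc n) = 4 * (real (ascents f n) + w + x + y)
      + (w\<^sup>2 + x\<^sup>2 + y\<^sup>2 + (z + 1)\<^sup>2) + (real n + 1) * (3 * w + 2 * x + y)"
      by (simp add: potential_def ascents_Suc letter_count_Suc less4 less3 counts add_ac)
    then show ?thesis
      using surplus[of 3 0 1 2 1] unfolding P n
      by (simp add: power2_eq_square field_simps)
  qed
qed

lemma no_harmonic_decrease:
  fixes q :: "nat \<Rightarrow> real"
  assumes "0 < c" and nonneg: "\<And>n. 0 \<le> q n"
    and decr: "\<And>n. N \<le> n \<Longrightarrow> q (Suc n) \<le> q n - c / real (Suc n)"
  shows False
proof -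
  have sum_le: "(\<Sum>i<m. c / real (Suc (i + N))) \<le> q N - q (m + N)" for m
  proof (induction m)
    case (Suc m)
    then show ?case
      using decr[of "m + N"] by simp
  qed simp
  have "summable (\<lambda>i. c / real (Suc (i + N)))"
  proof (rule summableI_nonneg_bounded)
    show "(\<Sum>i<m. c / real (Suc (i + N))) \<le> q N" for m
      using sum_le[of m] nonneg[of "m + N"] by linarith
  qed (use \<open>0 < c\<close> in auto)
  then have "summable (\<lambda>i. c * inverse (real (Suc (i + N))))"
    by (simp only: divide_inverse)
  then have "summable (\<lambda>i. inverse (real (i + Suc N)))"
    using \<open>0 < c\<close> by (subst (asm) summable_cmult_iff) simp
  then have "summable (\<lambda>i. inverse (real i))"
    by (subst (asm) summable_iff_shift)
  then show False
    using not_summable_harmonic[where 'a = real] by simp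
qed

text \<open>The ratio that decreases is \<open>P(n) / n\<^sup>2\<close>, because \<open>(1 + 2 / n) / (n + 1)\<^sup>2 \<le> 1 / n\<^sup>2\<close>.\<close>

lemma ascents_le_infinitely_often:
  assumes f: "\<And>v. v \<in> vertices \<Longrightarrow> f v < 4"
  shows "\<exists>n\<ge>N. real (ascents f n) \<le> (real n)\<^sup>2 / 4"
proof (rule ccontr)
  assume "\<not> ?thesis"
  then have many: "(real n)\<^sup>2 / 4 \<le> real (ascents f n)" if "N \<le> n" for n
    using that by force
  define q where "q n = potential f n / (real n)\<^sup>2" for n
  show False
  proof (rule no_harmonic_decrease[of "1 / 16" q "max N 32"])
    show "0 \<le> q n" for n
      by (simp add: q_def potential_nonneg)
  next
    fix n assume n: "max N 32 \<le> n"
    define t where "t = real n"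
    have t: "32 \<le> t"
      using n by (simp add: t_def)
    \<comment> \<open>For \<open>n \<ge> 32\<close> the error term \<open>4 n\<close> uses up only half of the gain \<open>n\<^sup>2 / 4\<close>.\<close>
    have "4 * t \<le> t\<^sup>2 / 8"
      using mult_right_mono[OF t, of t] t by (simp add: power2_eq_square)
    then have "t * (potential f (Suc n) - potential f n) \<le> 2 * potential f n - t\<^sup>2 / 8"
      using potential_step[of f n] f many[of n] n by (simp add: t_def)
    then have "t * potential f (Suc n) \<le> (t + 2) * potential f n - t\<^sup>2 / 8"
      by (simp add: algebra_simps)
    then have "t * (t * potential f (Suc n)) \<le> t * ((t + 2) * potential f n - t\<^sup>2 / 8)"
      using t by (intro mult_left_mono) auto
    also have "\<dots> \<le> (t + 1)\<^sup>2 * potential f n - t ^ 3 / 8"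
      using potential_nonneg[of f n] by (simp add: algebra_simps power2_eq_square power3_eq_cube)
    also have "\<dots> \<le> (t + 1)\<^sup>2 * potential f n - t\<^sup>2 * (t + 1) / 16"
      using t by (simp add: algebra_simps power2_eq_square power3_eq_cube)
    finally have "t * (t * potential f (Suc n)) / (t\<^sup>2 * (t + 1)\<^sup>2)
        \<le> ((t + 1)\<^sup>2 * potential f n - t\<^sup>2 * (t + 1) / 16) / (t\<^sup>2 * (t + 1)\<^sup>2)"
      by (rule divide_right_mono) simp
    moreover have "t * (t * potential f (Suc n)) / (t\<^sup>2 * (t + 1)\<^sup>2)
        = potential f (Suc n) / (t + 1)\<^sup>2"
      using t by (simp add: power2_eq_square)
    moreover have "((t + 1)\<^sup>2 * potential f n - t\<^sup>2 * (t + 1) / 16) / (t\<^sup>2 * (t + 1)\<^sup>2)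
        = potential f n / t\<^sup>2 - 1 / 16 / (t + 1)"
      using t by (simp add: diff_divide_distrib power2_eq_square)
    ultimately show "q (Suc n) \<le> q n - 1 / 16 / real (Suc n)"
      by (simp add: q_def t_def add.commute)
  qed simp
qed


section \<open>The bound on the lower density\<close>

theorem theorem1p4:
  shows "path_turan 4 \<le> ereal (1 / 4)"
  unfolding path_turan_def
proof (rule SUP_least)
  fix E assume "E \<in> {E. graph E \<and> I_free 4 E}"
  then have E: "graph E" "I_free 4 E"
    by auto
  from I_free_colouring[OF E] obtain f :: "nat \<Rightarrow> nat"
    where f: "\<And>v. v \<in> vertices \<Longrightarrow> f v < 4"
      and mono: "\<And>i j. i < j \<Longrightarrow> {i, j} \<in> E \<Longrightarrow> f i < f j"
    by blast
  show "lower_density E \<le> ereal (1 / 4)"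
  proof (rule ccontr)
    assume "\<not> ?thesis"
    then have "\<forall>\<^sub>F n in sequentially.
        ereal (1 / 4) < ereal (real (card (induced_edges E n)) / (real n)\<^sup>2)"
      unfolding lower_density_def by (intro less_LiminfD) auto
    then obtain N where
      N: "\<And>n. N \<le> n \<Longrightarrow> 1 / 4 < real (card (induced_edges E n)) / (real n)\<^sup>2"
      by (auto simp: eventually_sequentially)
    \<comment> \<open>\<open>Suc N\<close> excludes \<open>n = 0\<close>, for which the ratio is \<open>0 / 0 = 0\<close>.\<close>
    obtain n where n: "Suc N \<le> n" "real (ascents f n) \<le> (real n)\<^sup>2 / 4"
      using ascents_le_infinitely_often[of f "Suc N"] f by blast
    have "real (card (induced_edges E n)) \<le> (real n)\<^sup>2 / 4"
      using card_induced_edges_le_ascents[of E f n] E(1) mono n(2) by simp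
    then have "real (card (induced_edges E n)) / (real n)\<^sup>2 \<le> 1 / 4"
      using n(1) by (simp add: divide_simps)
    with N[of n] n(1) show False
      by simp
  qed
qed

end
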